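(* $|S_{St_n^3}(213)|=2^{n-3}(n+2)$ for all $n\geq 2$, and \[|S_{St_n^3}(123)|=|S_{St_n^3}(312)|=f_{2n-1}=\frac{1}{\sqrt{5}}\big(\psi^{2n-1}+\psi^{-(2n-1)}\big)\quad\text{for all } n\geq 1,\] where $f_n$ is the $n$-th Fibonacci number ($f_1=f_2=1$, $f_{n+2}=f_{n+1}+f_n$) and $\psi=(1+\sqrt{5})/2$.
   Context: $Y(a_1,\ldots,a_n)$, with $a_1\ge\cdots\ge a_n\ge 1$, denotes the left-justified Young diagram whose $i$-th row from the top has $a_i$ cells; $(x,y)$ denotes the cell in column $x$ (from the left) and row $y$ (from the bottom). $St^3_n$ is the Young diagram of size $n$ (with $n$ rows and $n$ columns) whose $j$-th row from the bottom has $\min(n,j+2)$ cells, $1\le j\le n$. In particular $St^3_n$ is the $n\times n$ square for $n\le 3$; for $n\ge4$ it is the third staircase diagram $Y(n,n,n,n-1,n-2,\ldots,4,3)$. For a Young diagram $Y$ with $n$ rows and $n$ columns, a transversal $T$ of $Y$ is a set of $n$ cells of $Y$ with exactly one in every row and every column; equivalently a permutation $\pi$ of $\{1,\ldots,n\}$ such that every cell $(x,\pi(x))$ lies in $Y$. $T$ contains the pattern $\tau\in S_k$ (one-line notation) in $Y$ if there are columns $x_1<\cdots<x_k$ such that $(\pi(x_1),\ldots,\pi(x_k))$ is order-isomorphic to $\tau$ and the cell $(x_k,\min_j\pi(x_j))$ belongs to $Y$. $S_Y(\tau)$ is the set of transversals of $Y$ that do not contain $\tau$ in $Y$. *)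

theory Defs
  imports Complex_Main "HOL-Combinatorics.Permutations" "HOL-Number_Theory.Fib"
begin

text \<open>
  A Young diagram is given by the list of its row lengths, from the top row to the bottom row
  (weakly decreasing and positive). The diagram is left-justified; a cell is a pair \<open>(x, y)\<close> of
  the column \<open>x\<close>, counted from the left, and the row \<open>y\<close>, counted from the \<^emph>\<open>bottom\<close>, both
  starting at \<open>1\<close>.
\<close>

definition young_diagram :: "nat list \<Rightarrow> bool" where
  "young_diagram Y \<longleftrightarrow> sorted_wrt (\<ge>) Y \<and> (\<forall>a\<in>set Y. a \<ge> 1)"

definition cells :: "nat list \<Rightarrow> (nat \<times> nat) set" where
  "cells Y = {(x, y). 1 \<le> y \<and> y \<le> length Y \<and> 1 \<le> x \<and> x \<le> Y ! (length Y - y)}"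

text \<open>
  Transversals of a diagram with as many columns as rows, in the form of permutations: the chosen
  cells are \<open>(x, \<pi> x)\<close>. As usual for \<open>permutes\<close>, \<open>\<pi>\<close> is the identity outside
  \<open>{1..length Y}\<close>, so distinct transversals are distinct functions.
\<close>

definition transversals :: "nat list \<Rightarrow> (nat \<Rightarrow> nat) set" where
  "transversals Y =
     {\<pi>. \<pi> permutes {1..length Y} \<and> (\<forall>x\<in>{1..length Y}. (x, \<pi> x) \<in> cells Y)}"

definition order_isomorphic :: "nat list \<Rightarrow> nat list \<Rightarrow> bool" where
  "order_isomorphic us vs \<longleftrightarrow>
     length us = length vs \<and>
     (\<forall>i<length us. \<forall>j<length us. us ! i < us ! j \<longleftrightarrow> vs ! i < vs ! j)"

text \<open>
  The pattern \<open>\<tau>\<close> is nonempty and in one-line notation; \<open>xs\<close> lists the columns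
  \<open>x\<^sub>1 < \<dots> < x\<^sub>k\<close> of an occurrence.
\<close>

definition contains_pattern :: "nat list \<Rightarrow> (nat \<Rightarrow> nat) \<Rightarrow> nat list \<Rightarrow> bool" where
  "contains_pattern Y \<pi> \<tau> \<longleftrightarrow>
     (\<exists>xs. set xs \<subseteq> {1..length Y} \<and> sorted_wrt (<) xs \<and>
           order_isomorphic (map \<pi> xs) \<tau> \<and>
           (last xs, Min (\<pi> ` set xs)) \<in> cells Y)"

definition avoiders :: "nat list \<Rightarrow> nat list \<Rightarrow> (nat \<Rightarrow> nat) set" where
  "avoiders Y \<tau> = {\<pi> \<in> transversals Y. \<not> contains_pattern Y \<pi> \<tau>}"

definition St3 :: "nat \<Rightarrow> nat list" where
  "St3 n = rev (map (\<lambda>j. min n (j + 2)) [1..<n + 1])"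

definition golden_ratio :: real where
  "golden_ratio = (1 + sqrt 5) / 2"

lemma length_St3 [simp]: "length (St3 n) = n"
  by (simp add: St3_def)

lemma young_diagram_St3: "young_diagram (St3 n)"
  by (auto simp: young_diagram_def St3_def sorted_wrt_rev sorted_wrt_iff_nth_less rev_nth simp del: upt_Suc)

lemma cells_St3: "(x, y) \<in> cells (St3 n) \<longleftrightarrow> 1 \<le> y \<and> y \<le> n \<and> 1 \<le> x \<and> x \<le> min n (y + 2)"
  by (auto simp: cells_def St3_def rev_nth simp del: upt_Suc)

lemma St3_ge_4: "n \<ge> 4 \<Longrightarrow> St3 n = [n, n] @ rev [3..<n + 1]"
  by (rule nth_equalityI) (auto simp: St3_def rev_nth nth_append nth_Cons' simp del: upt_Suc)

lemma bij_betw_transversals: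
  "bij_betw (\<lambda>\<pi>. (\<lambda>x. (x, \<pi> x)) ` {1..length Y}) (transversals Y)
     {T. T \<subseteq> cells Y \<and> T \<subseteq> {1..length Y} \<times> {1..length Y} \<and>
         (\<forall>x\<in>{1..length Y}. \<exists>!y. (x, y) \<in> T) \<and> (\<forall>y\<in>{1..length Y}. \<exists>!x. (x, y) \<in> T)}"
    (is "bij_betw ?f _ ?R")
proof (rule bij_betw_imageI)
  let ?I = "{1..length Y}"
  show "inj_on ?f (transversals Y)"
  proof (rule inj_onI)
    fix p q assume p: "p \<in> transversals Y" and q: "q \<in> transversals Y" and e: "?f p = ?f q"
    show "p = q"
    proof
      fix x
      show "p x = q x"
      proof (cases "x \<in> ?I")
        case True
        then have "(x, p x) \<in> ?f q" using e by blast
        then show ?thesis by auto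
      next
        case False
        moreover have "p permutes ?I" "q permutes ?I" using p q by (simp_all add: transversals_def)
        ultimately show ?thesis by (metis permutes_not_in)
      qed
    qed
  qed
  show "?f ` transversals Y = ?R"
  proof (intro equalityI subsetI)
    fix T assume "T \<in> ?f ` transversals Y"
    then obtain p where T: "T = ?f p" and p: "p permutes ?I" and c: "\<forall>x\<in>?I. (x, p x) \<in> cells Y"
      by (auto simp: transversals_def)
    have "\<exists>!x. (x, y) \<in> T" if y: "y \<in> ?I" for y
    proof (rule ex1I)
      have "inv p y \<in> ?I" using permutes_in_image[OF permutes_inv[OF p], of y] y by blast
      moreover have "p (inv p y) = y" by (rule permutes_inverses(1)[OF p])
      ultimately show "(inv p y, y) \<in> T" unfolding T by force
      fix x assume "(x, y) \<in> T"
      then show "x = inv p y" unfolding T using permutes_inverses(2)[OF p] by auto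
    qed
    moreover have "T \<subseteq> ?I \<times> ?I" unfolding T using permutes_in_image[OF p] by blast
    ultimately show "T \<in> ?R" using c unfolding T by auto
  next
    fix T assume "T \<in> ?R"
    then have sub: "T \<subseteq> cells Y" "T \<subseteq> ?I \<times> ?I"
      and col: "\<forall>x\<in>?I. \<exists>!y. (x, y) \<in> T" and row: "\<forall>y\<in>?I. \<exists>!x. (x, y) \<in> T" by blast+
    define p where "p x = (if x \<in> ?I then THE y. (x, y) \<in> T else x)" for x
    have pT: "(x, p x) \<in> T" if "x \<in> ?I" for x
      using theI'[OF bspec[OF col that]] that by (simp add: p_def)
    have T: "T = ?f p"
    proof (intro equalityI subsetI)
      fix c assume c: "c \<in> T"
      then obtain x y where xy: "c = (x, y)" "x \<in> ?I" using sub by blast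
      then have "y = p x" using col pT c by blast
      then show "c \<in> ?f p" using xy by blast
    qed (use pT in blast)
    have "p ` ?I \<subseteq> ?I" using pT sub by blast
    moreover have "inj_on p ?I"
    proof (rule inj_onI)
      fix x x' assume x: "x \<in> ?I" "x' \<in> ?I" and e: "p x = p x'"
      then have "(x, p x) \<in> T" "(x', p x) \<in> T" "p x \<in> ?I"
        using pT[of x] pT[of x'] sub by auto
      then show "x = x'" using row by blast
    qed
    ultimately have "bij_betw p ?I ?I"
      by (simp add: bij_betw_def endo_inj_surj)
    then have "p permutes ?I" by (rule bij_imp_permutes) (auto simp: p_def)
    then have "p \<in> transversals Y" using pT sub by (auto simp: transversals_def)
    then show "T \<in> ?f ` transversals Y" using T by blast
  qed
qed

end

theory Submission
  imports Defs
begin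

text \<open>
  For \<open>n \<ge> 2\<close>, the bottom row of the diagram \<open>St3 (n + 1)\<close> consists of the columns \<open>1, 2, 3\<close>.
  Deleting this row together with the column \<open>p\<close> of the cell that a transversal has in it leaves the
  diagram \<open>St3 n\<close> with a transversal \<open>\<sigma>\<close>, and every pair of \<open>p \<in> {1, 2, 3}\<close> and \<open>\<sigma>\<close> arises
  exactly once. For a pattern of length \<open>3\<close>, an occurrence that avoids the bottom
  row is an occurrence in \<open>\<sigma>\<close>, because its last column is larger than \<open>p\<close>, so that this column
  and the smallest row both drop by one. For an occurrence that uses the bottom row, the cell in its
  last column and row \<open>1\<close> must belong to the diagram, so it occupies the columns \<open>1, 2, 3\<close>
  (lemma \<open>contains_pattern_insert_bottom\<close>).

  Whether the columns \<open>1, 2, 3\<close> carry the pattern depends only on \<open>p\<close> and on the sign of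
  \<open>\<sigma> 2 - \<sigma> 1\<close>. Hence the numbers \<open>a\<close> and \<open>b\<close> of avoiders that begin with an ascent and with a
  descent satisfy a linear recurrence from \<open>n\<close> to \<open>n + 1\<close>, starting from \<open>a = b = 1\<close> at
  \<open>n = 2\<close>:
  \<^item> for 123, \<open>(a, b)\<close> becomes \<open>(a + b, a + 2 b)\<close>;
  \<^item> for 312, \<open>(a, b)\<close> becomes \<open>(2 a + b, a + b)\<close>;
  \<^item> for 213, \<open>(a, b)\<close> becomes \<open>(2 a + b, 2 b)\<close>.

  The solutions are consecutive Fibonacci numbers in the first two cases, and
  \<open>2 a = n 2 ^ (n - 2)\<close>, \<open>b = 2 ^ (n - 2)\<close> in the last one.
\<close>

section \<open>Transversals and occurrences in the third staircase\<close>

lemma transversals_St3_iff: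
  "\<pi> \<in> transversals (St3 n) \<longleftrightarrow> \<pi> permutes {1..n} \<and> (\<forall>x\<in>{1..n}. x \<le> \<pi> x + 2)"
proof -
  have "\<pi> x \<in> {1..n}" if "\<pi> permutes {1..n}" "x \<in> {1..n}" for x
    using permutes_in_image[OF that(1)] that(2) by blast
  then show ?thesis
    by (auto simp: transversals_def cells_St3)
qed

lemma finite_avoiders: "finite (avoiders Y \<tau>)"
  by (rule finite_subset[OF _ finite_permutations[of "{1..length Y}"]])
     (auto simp: avoiders_def transversals_def)

lemma order_isomorphic_map_Suc:
  "order_isomorphic (map Suc us) vs \<longleftrightarrow> order_isomorphic us vs"
  by (auto simp: order_isomorphic_def)

lemma contains_pattern_St3_iff:
  assumes \<pi>: "\<pi> permutes {1..n}" and \<tau>: "length \<tau> = 3"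
  shows "contains_pattern (St3 n) \<pi> \<tau> \<longleftrightarrow>
    (\<exists>x y z. 1 \<le> x \<and> x < y \<and> y < z \<and> z \<le> n \<and> order_isomorphic [\<pi> x, \<pi> y, \<pi> z] \<tau> \<and>
       z \<le> min (\<pi> x) (min (\<pi> y) (\<pi> z)) + 2)"
    (is "?L \<longleftrightarrow> ?R")
proof
  assume ?L
  then obtain xs where xs: "set xs \<subseteq> {1..n}" "sorted_wrt (<) xs"
    "order_isomorphic (map \<pi> xs) \<tau>" "(last xs, Min (\<pi> ` set xs)) \<in> cells (St3 n)"
    by (auto simp: contains_pattern_def)
  then have "length xs = 3" using \<tau> by (simp add: order_isomorphic_def)
  then obtain x y z where "xs = [x, y, z]"
    by (auto simp: eval_nat_numeral length_Suc_conv)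
  with xs show ?R
    by (intro exI[of _ x] exI[of _ y] exI[of _ z]) (auto simp: cells_St3)
next
  assume ?R
  then obtain x y z where xyz: "1 \<le> x" "x < y" "y < z" "z \<le> n"
    and o: "order_isomorphic [\<pi> x, \<pi> y, \<pi> z] \<tau>"
    and m: "z \<le> min (\<pi> x) (min (\<pi> y) (\<pi> z)) + 2" by blast
  have "\<pi> u \<in> {1..n}" if "u \<in> {1..n}" for u
    using permutes_in_image[OF \<pi>] that by blast
  then have "\<pi> x \<in> {1..n}" "\<pi> y \<in> {1..n}" "\<pi> z \<in> {1..n}" using xyz by simp_all
  then have "(z, min (\<pi> x) (min (\<pi> y) (\<pi> z))) \<in> cells (St3 n)"
    using xyz m by (simp add: cells_St3 min_le_iff_disj)
  then show ?L
    unfolding contains_pattern_def using xyz o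
    by (intro exI[of _ "[x, y, z]"]) simp
qed

section \<open>Inserting a bottom row\<close>

text \<open>
  For \<open>p \<ge> 1\<close>, \<open>insert_bottom p \<sigma>\<close> moves the rows of \<open>\<sigma>\<close> up and its columns from \<open>p\<close> on to the right, and
  places the new cell \<open>(p, 1)\<close>. The argument \<open>0\<close> is a fixed point, so that the result is again
  the identity outside its columns.
\<close>

definition insert_bottom :: "nat \<Rightarrow> (nat \<Rightarrow> nat) \<Rightarrow> nat \<Rightarrow> nat" where
  "insert_bottom p \<sigma> x =
     (if x = 0 then 0 else if x < p then Suc (\<sigma> x) else if x = p then 1 else Suc (\<sigma> (x - 1)))"

lemma insert_bottom_permutes:
  assumes \<sigma>: "\<sigma> permutes {1..n}" and p: "1 \<le> p" "p \<le> Suc n"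
  shows "insert_bottom p \<sigma> permutes {1..Suc n}"
proof -
  let ?\<pi> = "insert_bottom p \<sigma>"
  have inj: "\<sigma> x = \<sigma> y \<longleftrightarrow> x = y" for x y
    using permutes_inj[OF \<sigma>] by (simp add: inj_eq)
  have im: "\<sigma> x \<in> {1..n} \<longleftrightarrow> x \<in> {1..n}" for x
    by (rule permutes_in_image[OF \<sigma>])
  define d where "d x = (if x < p then x else x - 1)" for x
  have \<pi>d: "?\<pi> x = Suc (\<sigma> (d x)) \<and> \<sigma> (d x) \<in> {1..n}" if "x \<in> {1..Suc n}" "x \<noteq> p" for x
  proof
    show "?\<pi> x = Suc (\<sigma> (d x))" using that by (simp add: insert_bottom_def d_def)
    have "d x \<in> {1..n}" using that p by (auto simp: d_def)
    then show "\<sigma> (d x) \<in> {1..n}" by (simp only: im)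
  qed
  have \<pi>p: "?\<pi> p = 1" using p by (simp add: insert_bottom_def)
  have "?\<pi> x \<in> {1..Suc n}" if "x \<in> {1..Suc n}" for x
    using that \<pi>p \<pi>d[of x] by (cases "x = p") auto
  then have "?\<pi> ` {1..Suc n} \<subseteq> {1..Suc n}" by blast
  moreover have "inj_on ?\<pi> {1..Suc n}"
  proof (rule inj_onI)
    fix x y assume x: "x \<in> {1..Suc n}" and y: "y \<in> {1..Suc n}" and e: "?\<pi> x = ?\<pi> y"
    show "x = y"
    proof (cases "x = p \<or> y = p")
      case True
      then show ?thesis using \<pi>p \<pi>d[OF x] \<pi>d[OF y] e by (cases "x = p"; cases "y = p") auto
    next
      case False
      then have "d x = d y" using \<pi>d[OF x] \<pi>d[OF y] e by (simp add: inj)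
      then show ?thesis using False x y by (auto simp: d_def split: if_splits)
    qed
  qed
  ultimately have "bij_betw ?\<pi> {1..Suc n} {1..Suc n}"
    by (simp add: bij_betw_def endo_inj_surj)
  moreover have "?\<pi> x = x" if "x \<notin> {1..Suc n}" for x
  proof (cases "x = 0")
    case False
    then have "x - 1 \<notin> {1..n}" "p < x" using that p by auto
    moreover from this have "\<sigma> (x - 1) = x - 1" by (simp only: permutes_not_in[OF \<sigma>] not_False_eq_True)
    ultimately show ?thesis using False by (simp add: insert_bottom_def)
  qed (simp add: insert_bottom_def)
  ultimately show ?thesis by (rule bij_imp_permutes)
qed

lemma insert_bottom_transversal:
  assumes \<sigma>: "\<sigma> \<in> transversals (St3 n)" and n: "2 \<le> n" and p: "p \<in> {1..3}"
  shows "insert_bottom p \<sigma> \<in> transversals (St3 (Suc n))"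
proof -
  have le: "x \<le> \<sigma> x + 2" if "x \<in> {1..n}" for x using \<sigma> that by (simp add: transversals_St3_iff)
  have "x \<le> insert_bottom p \<sigma> x + 2" if x: "x \<in> {1..Suc n}" for x
  proof (cases "p < x")
    case True
    then have "x - 1 \<in> {1..n}" using x p by auto
    then have "x - 1 \<le> \<sigma> (x - 1) + 2" by (rule le)
    then show ?thesis using True x by (auto simp: insert_bottom_def)
  qed (use p in \<open>auto simp: insert_bottom_def\<close>)
  moreover have "insert_bottom p \<sigma> permutes {1..Suc n}"
    using \<sigma> n p by (intro insert_bottom_permutes) (auto simp: transversals_St3_iff)
  ultimately show ?thesis by (simp add: transversals_St3_iff)
qed

lemma inj_on_insert_bottom: "inj_on (insert_bottom p) (transversals (St3 n))"
proof (rule inj_onI)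
  fix \<sigma> \<rho>
  assume \<sigma>: "\<sigma> \<in> transversals (St3 n)" and \<rho>: "\<rho> \<in> transversals (St3 n)"
    and e: "insert_bottom p \<sigma> = insert_bottom p \<rho>"
  show "\<sigma> = \<rho>"
  proof
    fix x
    show "\<sigma> x = \<rho> x"
    proof (cases "x = 0")
      case True
      then have "x \<notin> {1..n}" by simp
      moreover have "\<sigma> permutes {1..n}" "\<rho> permutes {1..n}"
        using \<sigma> \<rho> by (simp_all add: transversals_St3_iff)
      ultimately show ?thesis by (metis permutes_not_in)
    next
      case False
      then show ?thesis
        using fun_cong[OF e, of x] fun_cong[OF e, of "Suc x"]
        by (auto simp: insert_bottom_def split: if_splits)
    qed
  qed
qed

lemma insert_bottom_surj:
  assumes \<pi>: "\<pi> \<in> transversals (St3 (Suc n))" and n: "2 \<le> n"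
  obtains p \<sigma> where "p \<in> {1..3}" "\<sigma> \<in> transversals (St3 n)" "\<pi> = insert_bottom p \<sigma>"
proof -
  have perm: "\<pi> permutes {1..Suc n}" and le: "\<And>x. x \<in> {1..Suc n} \<Longrightarrow> x \<le> \<pi> x + 2"
    using \<pi> by (auto simp: transversals_St3_iff)
  have inj: "\<pi> x = \<pi> y \<longleftrightarrow> x = y" for x y
    using permutes_inj[OF perm] by (simp add: inj_eq)
  have im: "\<pi> x \<in> {1..Suc n} \<longleftrightarrow> x \<in> {1..Suc n}" for x
    by (rule permutes_in_image[OF perm])
  define p where "p = inv \<pi> 1"
  have \<pi>p: "\<pi> p = 1" unfolding p_def by (rule permutes_inverses(1)[OF perm])
  then have p: "p \<in> {1..Suc n}" using im[of p] by simp
  then have p3: "p \<in> {1..3}" using le[of p] \<pi>p by auto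
  have ge2: "2 \<le> \<pi> x" if "x \<in> {1..Suc n}" "x \<noteq> p" for x
    using im[of x] that inj[of x p] \<pi>p by auto
  \<comment> \<open>Delete row \<open>1\<close> and column \<open>p\<close>.\<close>
  define \<sigma> where "\<sigma> x = (if x = 0 then 0 else if x < p then \<pi> x - 1 else \<pi> (Suc x) - 1)" for x
  have "\<sigma> ` {1..n} \<subseteq> {1..n}"
  proof
    fix y assume "y \<in> \<sigma> ` {1..n}"
    then obtain x where x: "y = \<sigma> x" "x \<in> {1..n}" by blast
    then show "y \<in> {1..n}"
      using im[of x] im[of "Suc x"] ge2[of x] ge2[of "Suc x"] by (auto simp: \<sigma>_def)
  qed
  moreover have "inj_on \<sigma> {1..n}"
  proof (rule inj_onI)
    fix x y assume xy: "x \<in> {1..n}" "y \<in> {1..n}" "\<sigma> x = \<sigma> y"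
    define s where "s u = (if u < p then u else Suc u)" for u
    have "\<sigma> u = \<pi> (s u) - 1 \<and> 2 \<le> \<pi> (s u)" if "u \<in> {1..n}" for u
      using that ge2[of "s u"] by (auto simp: \<sigma>_def s_def)
    then have "\<pi> (s x) = \<pi> (s y)" using xy by fastforce
    then show "x = y" unfolding inj by (auto simp: s_def split: if_splits)
  qed
  ultimately have "bij_betw \<sigma> {1..n} {1..n}"
    by (simp add: bij_betw_def endo_inj_surj)
  moreover have "\<sigma> x = x" if "x \<notin> {1..n}" for x
    using that p permutes_not_in[OF perm, of "Suc x"] by (auto simp: \<sigma>_def)
  ultimately have "\<sigma> permutes {1..n}" by (rule bij_imp_permutes)
  moreover have "x \<le> \<sigma> x + 2" if "x \<in> {1..n}" for x
    using that p3 le[of "Suc x"] by (auto simp: \<sigma>_def)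
  ultimately have "\<sigma> \<in> transversals (St3 n)" by (simp add: transversals_St3_iff)
  moreover have "\<pi> x = insert_bottom p \<sigma> x" for x
  proof (cases "x \<in> {1..Suc n}")
    case True
    then show ?thesis using \<pi>p p3 ge2[of x] by (cases "x = p") (auto simp: insert_bottom_def \<sigma>_def)
  next
    case False
    then show ?thesis
      using permutes_not_in[OF perm False] p by (auto simp: insert_bottom_def \<sigma>_def)
  qed
  then have "\<pi> = insert_bottom p \<sigma>" by blast
  ultimately show thesis using p3 that by blast
qed

lemma contains_pattern_insert_bottom:
  assumes \<sigma>: "\<sigma> \<in> transversals (St3 n)" and n: "2 \<le> n" and p: "p \<in> {1..3}"
    and \<tau>: "length \<tau> = 3"
  defines "\<pi> \<equiv> insert_bottom p \<sigma>"
  shows "contains_pattern (St3 (Suc n)) \<pi> \<tau> \<longleftrightarrow>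
    contains_pattern (St3 n) \<sigma> \<tau> \<or> order_isomorphic [\<pi> 1, \<pi> 2, \<pi> 3] \<tau>"
    (is "?L \<longleftrightarrow> ?R")
proof -
  have perm: "\<sigma> permutes {1..n}" using \<sigma> by (simp add: transversals_St3_iff)
  have perm': "\<pi> permutes {1..Suc n}"
    unfolding \<pi>_def using perm n p by (intro insert_bottom_permutes) auto
  have pos: "1 \<le> \<pi> x" if "1 \<le> x" for x using that by (auto simp: \<pi>_def insert_bottom_def)
  have oi: "order_isomorphic [Suc a, Suc b, Suc c] \<tau> \<longleftrightarrow> order_isomorphic [a, b, c] \<tau>" for a b c
    using order_isomorphic_map_Suc[of "[a, b, c]" \<tau>] by simp
  \<comment> \<open>\<open>s\<close> and \<open>d\<close> translate the columns of \<open>\<sigma>\<close> into those of \<open>\<pi>\<close> other than \<open>p\<close>, and back.\<close>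
  define s where "s x = (if x < p then x else Suc x)" for x
  define d where "d x = (if x < p then x else x - 1)" for x
  have \<pi>s: "\<pi> (s x) = Suc (\<sigma> x)" if "1 \<le> x" for x
    using that by (auto simp: \<pi>_def insert_bottom_def s_def)
  show ?thesis
  proof
    assume ?L
    then obtain x y z where xyz: "1 \<le> x" "x < y" "y < z" "z \<le> Suc n"
      and o: "order_isomorphic [\<pi> x, \<pi> y, \<pi> z] \<tau>"
      and m: "z \<le> min (\<pi> x) (min (\<pi> y) (\<pi> z)) + 2"
      unfolding contains_pattern_St3_iff[OF perm' \<tau>] by blast
    show ?R
    proof (cases "p \<in> {x, y, z}")
      case True
      moreover have "\<pi> p = 1" using p by (simp add: \<pi>_def insert_bottom_def)
      \<comment> \<open>The smallest row is \<open>1\<close>, whose last cell is in column \<open>3\<close>.\<close>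
      ultimately have "min (\<pi> x) (min (\<pi> y) (\<pi> z)) \<le> 1" by (auto simp: min_le_iff_disj)
      then have "x = 1" "y = 2" "z = 3" using xyz m by linarith+
      then show ?thesis using o by simp
    next
      case False
      then have sd: "s (d x) = x" "s (d y) = y" "s (d z) = z" by (auto simp: s_def d_def)
      have ord: "1 \<le> d x" "d x < d y" "d y < d z" "z = Suc (d z)"
        using False xyz p by (auto simp: d_def)
      have "\<pi> x = Suc (\<sigma> (d x))" "\<pi> y = Suc (\<sigma> (d y))" "\<pi> z = Suc (\<sigma> (d z))"
        using \<pi>s[of "d x"] \<pi>s[of "d y"] \<pi>s[of "d z"] sd ord by simp_all
      then have "order_isomorphic [\<sigma> (d x), \<sigma> (d y), \<sigma> (d z)] \<tau>"
        "d z \<le> min (\<sigma> (d x)) (min (\<sigma> (d y)) (\<sigma> (d z))) + 2" "d z \<le> n"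
        using o m ord xyz by (simp_all add: oi)
      then have "contains_pattern (St3 n) \<sigma> \<tau>"
        unfolding contains_pattern_St3_iff[OF perm \<tau>] using ord by blast
      then show ?thesis by blast
    qed
  next
    assume ?R
    then show ?L
    proof
      assume "contains_pattern (St3 n) \<sigma> \<tau>"
      then obtain x y z where xyz: "1 \<le> x" "x < y" "y < z" "z \<le> n"
        and o: "order_isomorphic [\<sigma> x, \<sigma> y, \<sigma> z] \<tau>"
        and m: "z \<le> min (\<sigma> x) (min (\<sigma> y) (\<sigma> z)) + 2"
        unfolding contains_pattern_St3_iff[OF perm \<tau>] by blast
      have "1 \<le> s x" "s x < s y" "s y < s z" "s z = Suc z" "s z \<le> Suc n"
        using xyz p by (auto simp: s_def)
      moreover have "order_isomorphic [\<pi> (s x), \<pi> (s y), \<pi> (s z)] \<tau>"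
        using o xyz by (simp add: \<pi>s oi)
      moreover have "s z \<le> min (\<pi> (s x)) (min (\<pi> (s y)) (\<pi> (s z))) + 2"
        using \<pi>s[of x] \<pi>s[of y] \<pi>s[of z] xyz m \<open>s z = Suc z\<close> by simp
      ultimately show ?L unfolding contains_pattern_St3_iff[OF perm' \<tau>] by blast
    next
      assume "order_isomorphic [\<pi> 1, \<pi> 2, \<pi> 3] \<tau>"
      then show ?L
        unfolding contains_pattern_St3_iff[OF perm' \<tau>] using n pos[of 1] pos[of 2] pos[of 3]
        by (intro exI[of _ 1] exI[of _ 2] exI[of _ 3]) auto
    qed
  qed
qed

section \<open>Recurrence for initial ascents and descents\<close>

text \<open>
  Avoiders whose first two values form an ascent, and those whose first two values form a descent;
  meaningful for \<open>n \<ge> 2\<close>.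
\<close>

definition asc_avoiders :: "nat \<Rightarrow> nat list \<Rightarrow> (nat \<Rightarrow> nat) set" where
  "asc_avoiders n \<tau> = {\<pi> \<in> avoiders (St3 n) \<tau>. \<pi> 1 < \<pi> 2}"

definition desc_avoiders :: "nat \<Rightarrow> nat list \<Rightarrow> (nat \<Rightarrow> nat) set" where
  "desc_avoiders n \<tau> = {\<pi> \<in> avoiders (St3 n) \<tau>. \<pi> 2 < \<pi> 1}"

lemma finite_asc_avoiders: "finite (asc_avoiders n \<tau>)"
  and finite_desc_avoiders: "finite (desc_avoiders n \<tau>)"
  by (simp_all add: asc_avoiders_def desc_avoiders_def finite_avoiders)

lemma avoiders_St3_first_neq:
  assumes "\<sigma> \<in> avoiders (St3 n) \<tau>"
  shows "\<sigma> 1 \<noteq> \<sigma> 2"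
proof -
  have "inj \<sigma>" using assms by (auto simp: avoiders_def transversals_St3_iff intro: permutes_inj)
  then show ?thesis by (simp add: inj_eq)
qed

lemma avoiders_St3_not_initial:
  "{\<sigma> \<in> avoiders (St3 n) \<tau>. \<not> \<sigma> 1 < \<sigma> 2} = desc_avoiders n \<tau>"
  "{\<sigma> \<in> avoiders (St3 n) \<tau>. \<not> \<sigma> 2 < \<sigma> 1} = asc_avoiders n \<tau>"
  unfolding asc_avoiders_def desc_avoiders_def
  by (rule Collect_cong, metis avoiders_St3_first_neq linorder_neqE_nat less_asym)+

lemma avoiders_St3_split:
  "avoiders (St3 n) \<tau> = asc_avoiders n \<tau> \<union> desc_avoiders n \<tau>"
  unfolding avoiders_St3_not_initial(1)[symmetric] unfolding asc_avoiders_def by blast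

lemma card_avoiders_St3:
  "card (avoiders (St3 n) \<tau>) = card (asc_avoiders n \<tau>) + card (desc_avoiders n \<tau>)"
  unfolding avoiders_St3_split
  by (intro card_Un_disjoint finite_asc_avoiders finite_desc_avoiders)
     (auto simp: asc_avoiders_def desc_avoiders_def)

lemma insert_bottom_avoiders_iff:
  assumes "\<sigma> \<in> transversals (St3 n)" "2 \<le> n" "p \<in> {1..3}" "length \<tau> = 3"
  shows "insert_bottom p \<sigma> \<in> avoiders (St3 (Suc n)) \<tau> \<longleftrightarrow>
    \<sigma> \<in> avoiders (St3 n) \<tau> \<and>
    \<not> order_isomorphic [insert_bottom p \<sigma> 1, insert_bottom p \<sigma> 2, insert_bottom p \<sigma> 3] \<tau>"
  using assms contains_pattern_insert_bottom[OF assms] insert_bottom_transversal[OF assms(1-3)]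
  by (auto simp: avoiders_def)

lemma insert_bottom_eq_column:
  assumes \<sigma>: "\<sigma> \<in> transversals (St3 n)" and \<rho>: "\<rho> \<in> transversals (St3 n)"
    and pq: "1 \<le> p" "1 \<le> q" and e: "insert_bottom p \<sigma> = insert_bottom q \<rho>"
  shows "p = q"
proof -
  have nz: "\<rho> x \<noteq> 0" if "1 \<le> x" for x
  proof -
    have perm: "\<rho> permutes {1..n}" using \<rho> by (simp add: transversals_St3_iff)
    have "\<rho> 0 = 0" using permutes_not_in[OF perm, of 0] by simp
    then show ?thesis using permutes_inj[OF perm] that by (metis injD not_one_le_zero)
  qed
  have one: "insert_bottom q \<rho> p = 1" using pq unfolding e[symmetric] by (simp add: insert_bottom_def)
  show ?thesis
  proof (cases p q rule: linorder_cases)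
    case less
    then show ?thesis using one nz[of p] pq by (simp add: insert_bottom_def)
  next
    case greater
    then have "1 \<le> p - 1" using pq by simp
    then show ?thesis using greater one nz[of "p - 1"] pq by (simp add: insert_bottom_def)
  qed
qed

text \<open>
  The avoiders of size \<open>n + 1\<close> with a property \<open>P\<close>, sorted by the column \<open>p\<close> of their cell in the
  bottom row.
\<close>

lemma card_avoiders_St3_Suc:
  assumes n: "2 \<le> n" and \<tau>: "length \<tau> = 3"
  shows "card {\<pi> \<in> avoiders (St3 (Suc n)) \<tau>. P \<pi>} =
    (\<Sum>p\<in>{1..3}. card {\<sigma> \<in> avoiders (St3 n) \<tau>. P (insert_bottom p \<sigma>) \<and>
       \<not> order_isomorphic [insert_bottom p \<sigma> 1, insert_bottom p \<sigma> 2, insert_bottom p \<sigma> 3] \<tau>})"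
    (is "card ?L = (\<Sum>p\<in>_. card (?A p))")
proof -
  have tr: "?A p \<subseteq> transversals (St3 n)" for p by (auto simp: avoiders_def)
  have "?L = (\<Union>p\<in>{1..3}. insert_bottom p ` ?A p)"
  proof (intro equalityI subsetI)
    fix \<pi> assume \<pi>: "\<pi> \<in> ?L"
    then obtain p \<sigma> where p\<sigma>: "p \<in> {1..3}" "\<sigma> \<in> transversals (St3 n)" "\<pi> = insert_bottom p \<sigma>"
      using insert_bottom_surj[OF _ n] by (auto simp: avoiders_def)
    then have "\<sigma> \<in> ?A p"
      using insert_bottom_avoiders_iff[OF p\<sigma>(2) n p\<sigma>(1) \<tau>] \<pi> by auto
    then show "\<pi> \<in> (\<Union>p\<in>{1..3}. insert_bottom p ` ?A p)" using p\<sigma> by blast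
  next
    fix \<pi> assume "\<pi> \<in> (\<Union>p\<in>{1..3}. insert_bottom p ` ?A p)"
    then obtain p \<sigma> where p\<sigma>: "p \<in> {1..3}" "\<sigma> \<in> ?A p" "\<pi> = insert_bottom p \<sigma>" by blast
    then show "\<pi> \<in> ?L"
      using insert_bottom_avoiders_iff[OF _ n p\<sigma>(1) \<tau>, of \<sigma>] tr by auto
  qed
  moreover have "insert_bottom p ` ?A p \<inter> insert_bottom q ` ?A q = {}"
    if "p \<in> {1..3}" "q \<in> {1..3}" "p \<noteq> q" for p q
  proof -
    have "insert_bottom p \<sigma> \<noteq> insert_bottom q \<rho>" if "\<sigma> \<in> ?A p" "\<rho> \<in> ?A q" for \<sigma> \<rho>
      using insert_bottom_eq_column[of \<sigma> n \<rho> p q] that tr \<open>p \<in> _\<close> \<open>q \<in> _\<close> \<open>p \<noteq> q\<close> by auto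
    then show ?thesis by blast
  qed
  ultimately have "card ?L = (\<Sum>p\<in>{1..3}. card (insert_bottom p ` ?A p))"
    by (simp add: card_UN_disjoint finite_avoiders)
  moreover have "card (insert_bottom p ` ?A p) = card (?A p)" for p
    by (intro card_image inj_on_subset[OF inj_on_insert_bottom tr])
  ultimately show ?thesis by (simp only:)
qed

lemma insert_bottom_first_columns:
  "insert_bottom 1 \<sigma> 1 = 1" "insert_bottom 1 \<sigma> 2 = Suc (\<sigma> 1)" "insert_bottom 1 \<sigma> 3 = Suc (\<sigma> 2)"
  "insert_bottom 2 \<sigma> 1 = Suc (\<sigma> 1)" "insert_bottom 2 \<sigma> 2 = 1" "insert_bottom 2 \<sigma> 3 = Suc (\<sigma> 2)"
  "insert_bottom 3 \<sigma> 1 = Suc (\<sigma> 1)" "insert_bottom 3 \<sigma> 2 = Suc (\<sigma> 2)" "insert_bottom 3 \<sigma> 3 = 1"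
  by (simp_all add: insert_bottom_def)

lemma avoiders_St3_first_pos:
  assumes "\<sigma> \<in> avoiders (St3 n) \<tau>" "2 \<le> n"
  shows "0 < \<sigma> 1" "0 < \<sigma> 2"
proof -
  have "\<sigma> permutes {1..n}" using assms(1) by (simp add: avoiders_def transversals_St3_iff)
  from permutes_in_image[OF this, of 1] permutes_in_image[OF this, of 2] assms(2)
  show "0 < \<sigma> 1" "0 < \<sigma> 2" by auto
qed

text \<open>
  An ascent at the start is created by \<open>p = 1\<close>, destroyed by \<open>p = 2\<close> and inherited from \<open>\<sigma>\<close> for
  \<open>p = 3\<close>; for a descent the roles of \<open>p = 1\<close> and \<open>p = 2\<close> are exchanged.
\<close>

lemma card_asc_avoiders_Suc:
  assumes n: "2 \<le> n" and \<tau>: "length \<tau> = 3"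
  shows "card (asc_avoiders (Suc n) \<tau>) =
    card {\<sigma> \<in> avoiders (St3 n) \<tau>. \<not> order_isomorphic [1, Suc (\<sigma> 1), Suc (\<sigma> 2)] \<tau>} +
    card {\<sigma> \<in> asc_avoiders n \<tau>. \<not> order_isomorphic [Suc (\<sigma> 1), Suc (\<sigma> 2), 1] \<tau>}"
proof -
  have "{1..3} = {1, 2, 3 :: nat}" by auto
  then show ?thesis
    using avoiders_St3_first_pos[OF _ n, of _ \<tau>]
    unfolding asc_avoiders_def card_avoiders_St3_Suc[OF n \<tau>]
    by (auto simp: insert_bottom_first_columns[unfolded One_nat_def] conj_assoc
        intro!: arg_cong2[of _ _ _ _ "(+)"] arg_cong[of _ _ card])
qed

lemma card_desc_avoiders_Suc:
  assumes n: "2 \<le> n" and \<tau>: "length \<tau> = 3"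
  shows "card (desc_avoiders (Suc n) \<tau>) =
    card {\<sigma> \<in> avoiders (St3 n) \<tau>. \<not> order_isomorphic [Suc (\<sigma> 1), 1, Suc (\<sigma> 2)] \<tau>} +
    card {\<sigma> \<in> desc_avoiders n \<tau>. \<not> order_isomorphic [Suc (\<sigma> 1), Suc (\<sigma> 2), 1] \<tau>}"
proof -
  have "{1..3} = {1, 2, 3 :: nat}" by auto
  then show ?thesis
    using avoiders_St3_first_pos[OF _ n, of _ \<tau>]
    unfolding desc_avoiders_def card_avoiders_St3_Suc[OF n \<tau>]
    by (auto simp: insert_bottom_first_columns[unfolded One_nat_def] conj_assoc
        intro!: arg_cong2[of _ _ _ _ "(+)"] arg_cong[of _ _ card])
qed

lemma order_isomorphic_3:
  "order_isomorphic [u, v, w] [1, 2, 3] \<longleftrightarrow> u < v \<and> v < w"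
  "order_isomorphic [u, v, w] [3, 1, 2] \<longleftrightarrow> v < w \<and> w < u"
  "order_isomorphic [u, v, w] [2, 1, 3] \<longleftrightarrow> v < u \<and> u < w"
  unfolding order_isomorphic_def
  by (simp add: All_less_Suc2, metis less_asym less_trans less_irrefl)+

lemma card_avoiders_123_Suc:
  assumes n: "2 \<le> n"
  shows "card (asc_avoiders (Suc n) [1, 2, 3]) =
      card (asc_avoiders n [1, 2, 3]) + card (desc_avoiders n [1, 2, 3])"
    and "card (desc_avoiders (Suc n) [1, 2, 3]) =
      card (asc_avoiders n [1, 2, 3]) + 2 * card (desc_avoiders n [1, 2, 3])"
proof -
  have "{\<sigma> \<in> avoiders (St3 n) [1, 2, 3]. \<not> (1 < Suc (\<sigma> 1) \<and> Suc (\<sigma> 1) < Suc (\<sigma> 2))} =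
      desc_avoiders n [1, 2, 3]"
    unfolding avoiders_St3_not_initial(1)[symmetric]
    by (rule Collect_cong) (metis avoiders_St3_first_pos[OF _ n] One_nat_def Suc_less_eq)
  then show "card (asc_avoiders (Suc n) [1, 2, 3]) =
      card (asc_avoiders n [1, 2, 3]) + card (desc_avoiders n [1, 2, 3])"
    by (simp add: card_asc_avoiders_Suc[OF n] order_isomorphic_3[unfolded One_nat_def])
  show "card (desc_avoiders (Suc n) [1, 2, 3]) =
      card (asc_avoiders n [1, 2, 3]) + 2 * card (desc_avoiders n [1, 2, 3])"
    by (simp add: card_desc_avoiders_Suc[OF n] order_isomorphic_3[unfolded One_nat_def]
        card_avoiders_St3)
qed

lemma card_avoiders_312_Suc:
  assumes n: "2 \<le> n"
  shows "card (asc_avoiders (Suc n) [3, 1, 2]) =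
      2 * card (asc_avoiders n [3, 1, 2]) + card (desc_avoiders n [3, 1, 2])"
    and "card (desc_avoiders (Suc n) [3, 1, 2]) =
      card (asc_avoiders n [3, 1, 2]) + card (desc_avoiders n [3, 1, 2])"
proof -
  have "{\<sigma> \<in> avoiders (St3 n) [3, 1, 2]. \<not> (1 < Suc (\<sigma> 2) \<and> Suc (\<sigma> 2) < Suc (\<sigma> 1))} =
      asc_avoiders n [3, 1, 2]"
    unfolding avoiders_St3_not_initial(2)[symmetric]
    by (rule Collect_cong) (metis avoiders_St3_first_pos[OF _ n] One_nat_def Suc_less_eq)
  then show "card (desc_avoiders (Suc n) [3, 1, 2]) =
      card (asc_avoiders n [3, 1, 2]) + card (desc_avoiders n [3, 1, 2])"
    by (simp add: card_desc_avoiders_Suc[OF n] order_isomorphic_3[unfolded One_nat_def])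
  show "card (asc_avoiders (Suc n) [3, 1, 2]) =
      2 * card (asc_avoiders n [3, 1, 2]) + card (desc_avoiders n [3, 1, 2])"
    by (simp add: card_asc_avoiders_Suc[OF n] order_isomorphic_3[unfolded One_nat_def]
        card_avoiders_St3)
qed

lemma card_avoiders_213_Suc:
  assumes n: "2 \<le> n"
  shows "card (asc_avoiders (Suc n) [2, 1, 3]) =
      2 * card (asc_avoiders n [2, 1, 3]) + card (desc_avoiders n [2, 1, 3])"
    and "card (desc_avoiders (Suc n) [2, 1, 3]) = 2 * card (desc_avoiders n [2, 1, 3])"
proof -
  have "{\<sigma> \<in> avoiders (St3 n) [2, 1, 3]. \<not> (1 < Suc (\<sigma> 1) \<and> Suc (\<sigma> 1) < Suc (\<sigma> 2))} =
      desc_avoiders n [2, 1, 3]"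
    unfolding avoiders_St3_not_initial(1)[symmetric]
    by (rule Collect_cong) (metis avoiders_St3_first_pos[OF _ n] One_nat_def Suc_less_eq)
  then show "card (desc_avoiders (Suc n) [2, 1, 3]) = 2 * card (desc_avoiders n [2, 1, 3])"
    by (simp add: card_desc_avoiders_Suc[OF n] order_isomorphic_3[unfolded One_nat_def])
  show "card (asc_avoiders (Suc n) [2, 1, 3]) =
      2 * card (asc_avoiders n [2, 1, 3]) + card (desc_avoiders n [2, 1, 3])"
    by (simp add: card_asc_avoiders_Suc[OF n] order_isomorphic_3[unfolded One_nat_def]
        card_avoiders_St3)
qed

section \<open>Small diagrams and solution of the recurrences\<close>

lemma not_contains_pattern_small:
  assumes "\<pi> permutes {1..n}" "length \<tau> = 3" "n \<le> 2"
  shows "\<not> contains_pattern (St3 n) \<pi> \<tau>"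
  unfolding contains_pattern_St3_iff[OF assms(1,2)] using assms(3) by auto

lemma avoiders_St3_small:
  assumes "length \<tau> = 3" "n \<le> 2"
  shows "avoiders (St3 n) \<tau> = {\<pi>. \<pi> permutes {1..n}}"
  using assms not_contains_pattern_small[OF _ assms] by (auto simp: avoiders_def transversals_St3_iff)

lemma card_avoiders_St3_1: "length \<tau> = 3 \<Longrightarrow> card (avoiders (St3 1) \<tau>) = 1"
  using card_permutations[of "{1..1::nat}" 1] by (simp add: avoiders_St3_small)

lemma card_initial_avoiders_St3_2:
  assumes "length \<tau> = 3"
  shows "card (asc_avoiders 2 \<tau>) = 1" "card (desc_avoiders 2 \<tau>) = 1"
proof -
  have *: "{1..2} = {1, 2 :: nat}" by auto
  have "\<pi> permutes {1..2} \<longleftrightarrow> \<pi> = id \<or> \<pi> = transpose 1 2" for \<pi> :: "nat \<Rightarrow> nat"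
    unfolding * by (rule permutes_doubleton_iff)
  then have "asc_avoiders 2 \<tau> = {id}" "desc_avoiders 2 \<tau> = {transpose 1 2}"
    using assms by (auto simp: asc_avoiders_def desc_avoiders_def avoiders_St3_small)
  then show "card (asc_avoiders 2 \<tau>) = 1" "card (desc_avoiders 2 \<tau>) = 1" by simp_all
qed

lemma card_initial_avoiders_123:
  assumes "2 \<le> n"
  shows "card (asc_avoiders n [1, 2, 3]) = fib (2 * n - 3) \<and>
    card (desc_avoiders n [1, 2, 3]) = fib (2 * n - 2)"
  using assms
proof (induction n rule: dec_induct)
  case base
  show ?case using card_initial_avoiders_St3_2[of "[1, 2, 3]"] by simp
next
  case (step n)
  then obtain m where "n = Suc (Suc m)" by (metis add_2_eq_Suc le_Suc_ex)
  then show ?case using step by (simp add: card_avoiders_123_Suc[unfolded One_nat_def])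
qed

lemma card_initial_avoiders_312:
  assumes "2 \<le> n"
  shows "card (asc_avoiders n [3, 1, 2]) = fib (2 * n - 2) \<and>
    card (desc_avoiders n [3, 1, 2]) = fib (2 * n - 3)"
  using assms
proof (induction n rule: dec_induct)
  case base
  show ?case using card_initial_avoiders_St3_2[of "[3, 1, 2]"] by simp
next
  case (step n)
  then obtain m where "n = Suc (Suc m)" by (metis add_2_eq_Suc le_Suc_ex)
  then show ?case using step by (simp add: card_avoiders_312_Suc[unfolded One_nat_def])
qed

lemma card_initial_avoiders_213:
  assumes "2 \<le> n"
  shows "2 * card (asc_avoiders n [2, 1, 3]) = n * 2 ^ (n - 2) \<and>
    card (desc_avoiders n [2, 1, 3]) = 2 ^ (n - 2)"
  using assms
proof (induction n rule: dec_induct)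
  case base
  show ?case using card_initial_avoiders_St3_2[of "[2, 1, 3]"] by simp
next
  case (step n)
  then obtain m where "n = Suc (Suc m)" by (metis add_2_eq_Suc le_Suc_ex)
  then show ?case using step by (simp add: card_avoiders_213_Suc[unfolded One_nat_def] algebra_simps)
qed

lemma card_avoiders_fib:
  assumes "1 \<le> n" and \<tau>: "\<tau> = [1, 2, 3] \<or> \<tau> = [3, 1, 2]"
  shows "card (avoiders (St3 n) \<tau>) = fib (2 * n - 1)"
proof (cases "n = 1")
  case True
  then show ?thesis using card_avoiders_St3_1[of \<tau>] \<tau> by auto
next
  case False
  then have n: "2 \<le> n" using assms(1) by simp
  then obtain m where m: "n = Suc (Suc m)" by (metis add_2_eq_Suc le_Suc_ex)
  have "fib (2 * n - 1) = fib (2 * n - 2) + fib (2 * n - 3)" by (simp add: m)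
  then show ?thesis
    using card_initial_avoiders_123[OF n] card_initial_avoiders_312[OF n] \<tau>
    by (elim disjE) (simp_all only: card_avoiders_St3 add.commute)
qed

text \<open>Binet's formula; the conjugate of the golden ratio is the negative of its inverse.\<close>

lemma fib_odd_golden_ratio:
  assumes "odd k"
  shows "real (fib k) = 1 / sqrt 5 * (golden_ratio ^ k + golden_ratio powi (- int k))"
proof -
  have "golden_ratio * ((1 - sqrt 5) / 2) = - 1"
    by (simp add: golden_ratio_def field_simps)
  then have conj: "(1 - sqrt 5) / 2 = - inverse golden_ratio"
    by (metis inverse_minus_eq inverse_unique minus_equation_iff mult_minus_right)
  have "((1 - sqrt 5) / 2) ^ k = - (golden_ratio powi (- int k))"
    unfolding conj using assms by (simp add: power_int_minus power_inverse)
  moreover have "real (fib k) = (golden_ratio ^ k - ((1 - sqrt 5) / 2) ^ k) / sqrt 5"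
    using fib_closed_form[of k] by (simp add: golden_ratio_def)
  ultimately show ?thesis by simp
qed

theorem proposition12:
  shows "(\<forall>n\<ge>2. real (card (avoiders (St3 n) [2, 1, 3])) = 2 powi (int n - 3) * (real n + 2)) \<and>
    (\<forall>n\<ge>1. card (avoiders (St3 n) [1, 2, 3]) = card (avoiders (St3 n) [3, 1, 2]) \<and>
       card (avoiders (St3 n) [3, 1, 2]) = fib (2 * n - 1) \<and>
       real (fib (2 * n - 1)) =
         1 / sqrt 5 * (golden_ratio ^ (2 * n - 1) + golden_ratio powi (- int (2 * n - 1))))"
proof (intro conjI allI impI)
  fix n :: nat assume n: "n \<ge> 2"
  then obtain m where m: "n = m + 2" by (metis le_Suc_ex add.commute)
  have "2 * card (avoiders (St3 n) [2, 1, 3]) = (n + 2) * 2 ^ m"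
    using card_initial_avoiders_213[OF n] m by (simp add: card_avoiders_St3)
  then have "real (2 * card (avoiders (St3 n) [2, 1, 3])) = real ((n + 2) * 2 ^ m)"
    by (rule arg_cong)
  then have "real (card (avoiders (St3 n) [2, 1, 3])) = 2 ^ m / 2 * (real n + 2)"
    by (simp add: field_simps)
  moreover have "int n - 3 = int m - 1" using m by simp
  then have "(2 :: real) powi (int n - 3) = 2 ^ m / 2" by (simp add: power_int_diff)
  ultimately show "real (card (avoiders (St3 n) [2, 1, 3])) = 2 powi (int n - 3) * (real n + 2)"
    by (simp only:)
next
  fix n :: nat assume n: "n \<ge> 1"
  show "card (avoiders (St3 n) [3, 1, 2]) = fib (2 * n - 1)"
    using card_avoiders_fib[OF n] by blast
  then show "card (avoiders (St3 n) [1, 2, 3]) = card (avoiders (St3 n) [3, 1, 2])"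
    using card_avoiders_fib[OF n] by simp
  show "real (fib (2 * n - 1)) =
      1 / sqrt 5 * (golden_ratio ^ (2 * n - 1) + golden_ratio powi (- int (2 * n - 1)))"
    using n by (intro fib_odd_golden_ratio) simp
qed

end
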